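(* Let $G$ be a formula and let $\mathcal{D}$ be an $\mathbf{FRJ}(G)$-derivation of $G$. Then $\mathrm{Mod}(\mathcal D)$ is a countermodel for $G$, i.e. its root does not force $G$.
   Context: Formulas are built from a countably infinite set $\mathcal{V}$ of propositional variables and $\bot$ using $\land,\lor,\supset$. Let $\mathcal{V}_\bot=\mathcal{V}\cup\{\bot\}$, $\mathcal{L}^{\supset}$ the set of formulas with main connective $\supset$. For a formula $G$, $\mathrm{Sl}(G)$ and $\mathrm{Sr}(G)$ are the smallest subsets of the subformulas of $G$ with: $G\in\mathrm{Sr}(G)$; $A\land B$ or $A\lor B$ in $\mathrm{Sl}(G)$ (resp. $\mathrm{Sr}(G)$) implies $A,B$ in $\mathrm{Sl}(G)$ (resp. $\mathrm{Sr}(G)$); $A\supset B\in\mathrm{Sl}(G)$ implies $B\in\mathrm{Sl}(G)$, $A\in\mathrm{Sr}(G)$; $A\supset B\in\mathrm{Sr}(G)$ implies $B\in\mathrm{Sr}(G)$, $A\in\mathrm{Sl}(G)$. $\mathrm{Cl}(\Gamma)$ is the smallest set containing $\Gamma$ such that if $X,Y\in\mathrm{Cl}(\Gamma)$ and $A$ is any formula then $X\land Y,A\lor X,X\lor A,A\supset X\in\mathrm{Cl}(\Gamma)$. $\mathbf{FRJ}(G)$: let $\bar\Gamma^{At}=\mathrm{Sl}(G)\cap\mathcal V$, $\bar\Gamma^{\supset}=\mathrm{Sl}(G)\cap\mathcal L^{\supset}$, $\bar\Gamma=\bar\Gamma^{At}\cup\bar\Gamma^{\supset}$. Sequents: regular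 $\Gamma\Rightarrow C$ ($\Gamma\subseteq\bar\Gamma$, $C\in\mathrm{Sr}(G)$), irregular $\Sigma;\Theta\rightarrow C$ ($\Sigma\cup\Theta\subseteq\bar\Gamma$, $C\in\mathrm{Sr}(G)$); $\mathrm{Lhs}$ is $\Gamma$, resp. $\Sigma\cup\Theta$; conclusions always have right formula in $\mathrm{Sr}(G)$. Rules ($F\in\mathcal V_\bot$, $k\in\{1,2\}$): axioms $\bar\Gamma^{At}\setminus\{F\}\Rightarrow F$ and $\emptyset;(\bar\Gamma^{At}\setminus\{F\})\cup\bar\Gamma^{\supset}\rightarrow F$; ($\land$) $\Gamma\Rightarrow A_k/\Gamma\Rightarrow A_1\land A_2$ and $\Sigma;\Theta\rightarrow A_k/\Sigma;\Theta\rightarrow A_1\land A_2$; ($\lor$) $\Sigma_1;\Theta_1\rightarrow C_1$, $\Sigma_2;\Theta_2\rightarrow C_2 / \Sigma_1\cup\Sigma_2;\Theta_1\cap\Theta_2\rightarrow C_1\lor C_2$ if $\Sigma_1\subseteq\Sigma_2\cup\Theta_2$, $\Sigma_2\subseteq\Sigma_1\cup\Theta_1$; ($\supset_\in$) $\Gamma\Rightarrow B/\Gamma\Rightarrow A\supset B$ if $A\in\mathrm{Cl}(\Gamma)$, and $\Sigma;\Theta\cup\Lambda\rightarrow B/\Sigma\cup\Lambda;\Theta\rightarrow A\supset B$ if $\Theta\cap\Lambda=\emptyset$, $A\in\mathrm{Cl}(\Sigma\cup\Lambda)$ and no $\Lambda'\subsetneq\Lambda$ has $A\in\mathrm{Cl}(\Sigma\cup\Lambda')$;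 ($\supset_{\notin}$) $\Gamma\Rightarrow B/\emptyset;\Theta\rightarrow A\supset B$ if $\Theta\subseteq\mathrm{Cl}(\Gamma)\cap\bar\Gamma$, $A\in\mathrm{Cl}(\Gamma)\setminus\mathrm{Cl}(\Theta)$ and every $\Theta'$ with $\Theta\subsetneq\Theta'\subseteq\mathrm{Cl}(\Gamma)\cap\bar\Gamma$ has $A\in\mathrm{Cl}(\Theta')$; join rules with premises $\Sigma_j;\Theta_j\rightarrow A_j$ ($1\le j\le n$, $n\ge1$): let $\Upsilon=\{A_1,\dots,A_n\}$, $\Sigma^{At}=\bigcup_j(\Sigma_j\cap\mathcal V)$, $\Sigma^{\supset}=\bigcup_j(\Sigma_j\cap\mathcal L^{\supset})$, $\Theta^{At}=\bigcap_j(\Theta_j\cap\mathcal V)$, $\Theta^{\supset}=\{Y\supset Z\in\bigcap_j(\Theta_j\cap\mathcal L^{\supset}):Y\in\Upsilon\}$, requiring $\Sigma_i\subseteq\Sigma_j\cup\Theta_j$ ($i\ne j$) and ($Y\supset Z\in\Sigma^{\supset}\Rightarrow Y\in\Upsilon$); ($\bowtie^{At}$) conclusion $\Sigma^{At}\cup(\Theta^{At}\setminus\{F\})\cup\Sigma^{\supset}\cup\Theta^{\supset}\Rightarrow F$, $F\in\mathcal V_\bot\setminus\Sigma^{At}$, where each $Y\in\Upsilon$ has some $Y\supset Z\in\mathrm{Sl}(G)$; ($\bowtie^{\lor}$) conclusion $\Sigma^{At}\cup\Theta^{At}\cup\Sigma^{\supset}\cup\Theta^{\supset}\Rightarrow C_1\lor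 C_2$, $\{C_1,C_2\}\subseteq\Upsilon$, where each $Y\in\Upsilon$ has some $Y\supset Z\in\mathrm{Sl}(G)$ or $Y\lor Z\in\mathrm{Sr}(G)$ or $Z\lor Y\in\mathrm{Sr}(G)$. An $\mathbf{FRJ}(G)$-derivation of $G$ is a derivation (finite tree with axioms at leaves) of some regular sequent $\Gamma\Rightarrow G$. Write $\sigma_1\mapsto_0\sigma_2$ if some rule instance has conclusion $\sigma_2$ and $\sigma_1$ among its premises; $\mapsto_*$ is the reflexive-transitive closure. For a derivation $\mathcal D$ of $G$, a p-sequent is a regular sequent occurring in $\mathcal D$ that is an axiom or the conclusion of a join rule; $\mathrm{Mod}(\mathcal D)=(P,\le,\rho,V)$ where $P$ is the set of p-sequents of $\mathcal D$, $\sigma_1\le\sigma_2$ iff $\sigma_2\mapsto_*\sigma_1$, $\rho$ is the $\le$-minimum, and $V(\sigma)=\mathrm{Lhs}(\sigma)\cap\mathcal V$; this is a Kripke model with standard intuitionistic forcing. *)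

theory Defs
  imports Main
begin

datatype fm =
    Var nat
  | Bot
  | And fm fm
  | Or fm fm
  | Imp fm fm

definition Vars :: "fm set" where
  "Vars = range Var"

definition VarsBot :: "fm set" where
  "VarsBot = Vars \<union> {Bot}"

definition Imps :: "fm set" where
  "Imps = {Imp A B | A B. True}"

inductive_set Sl :: "fm \<Rightarrow> fm set" and Sr :: "fm \<Rightarrow> fm set" for G :: fm where
  Sr_self: "G \<in> Sr G"
| Sl_And1: "And A B \<in> Sl G \<Longrightarrow> A \<in> Sl G"
| Sl_And2: "And A B \<in> Sl G \<Longrightarrow> B \<in> Sl G"
| Sl_Or1: "Or A B \<in> Sl G \<Longrightarrow> A \<in> Sl G"
| Sl_Or2: "Or A B \<in> Sl G \<Longrightarrow> B \<in> Sl G"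
| Sr_And1: "And A B \<in> Sr G \<Longrightarrow> A \<in> Sr G"
| Sr_And2: "And A B \<in> Sr G \<Longrightarrow> B \<in> Sr G"
| Sr_Or1: "Or A B \<in> Sr G \<Longrightarrow> A \<in> Sr G"
| Sr_Or2: "Or A B \<in> Sr G \<Longrightarrow> B \<in> Sr G"
| Sl_Imp_right: "Imp A B \<in> Sl G \<Longrightarrow> B \<in> Sl G"
| Sl_Imp_left: "Imp A B \<in> Sl G \<Longrightarrow> A \<in> Sr G"
| Sr_Imp_right: "Imp A B \<in> Sr G \<Longrightarrow> B \<in> Sr G"
| Sr_Imp_left: "Imp A B \<in> Sr G \<Longrightarrow> A \<in> Sl G"

inductive_set Cl :: "fm set \<Rightarrow> fm set" for \<Gamma> :: "fm set" where
  Cl_base: "X \<in> \<Gamma> \<Longrightarrow> X \<in> Cl \<Gamma>"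
| Cl_And: "X \<in> Cl \<Gamma> \<Longrightarrow> Y \<in> Cl \<Gamma> \<Longrightarrow> And X Y \<in> Cl \<Gamma>"
| Cl_Or_right: "X \<in> Cl \<Gamma> \<Longrightarrow> Or A X \<in> Cl \<Gamma>"
| Cl_Or_left: "X \<in> Cl \<Gamma> \<Longrightarrow> Or X A \<in> Cl \<Gamma>"
| Cl_Imp: "X \<in> Cl \<Gamma> \<Longrightarrow> Imp A X \<in> Cl \<Gamma>"

definition GammaAt :: "fm \<Rightarrow> fm set" where
  "GammaAt G = Sl G \<inter> Vars"

definition GammaImp :: "fm \<Rightarrow> fm set" where
  "GammaImp G = Sl G \<inter> Imps"

definition GammaBar :: "fm \<Rightarrow> fm set" where
  "GammaBar G = GammaAt G \<union> GammaImp G"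

text \<open>\<open>Reg \<Gamma> C\<close> is the regular sequent with left-hand side \<open>\<Gamma>\<close> and right formula \<open>C\<close>;
  \<open>Irr \<Sigma> \<Theta> C\<close> is the irregular sequent with left-hand sides \<open>\<Sigma>\<close>; \<open>\<Theta>\<close> and right formula \<open>C\<close>.\<close>

datatype seqt =
    Reg "fm set" fm
  | Irr "fm set" "fm set" fm

fun Lhs :: "seqt \<Rightarrow> fm set" where
  "Lhs (Reg \<Gamma> C) = \<Gamma>"
| "Lhs (Irr \<Sigma> \<Theta> C) = \<Sigma> \<union> \<Theta>"

fun Rhs :: "seqt \<Rightarrow> fm" where
  "Rhs (Reg \<Gamma> C) = C"
| "Rhs (Irr \<Sigma> \<Theta> C) = C"

definition is_sequent :: "fm \<Rightarrow> seqt \<Rightarrow> bool" where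
  "is_sequent G s \<longleftrightarrow> Lhs s \<subseteq> GammaBar G \<and> Rhs s \<in> Sr G"

text \<open>The predicates \<open>axiom_shape\<close>, \<open>unary_shape\<close>, \<open>or_shape\<close> and \<open>join_shape\<close> give the schematic
  form of the rules together with their side conditions; that premises and conclusion are
  sequents of FRJ(G) is imposed on all rules at once below.\<close>

inductive axiom_shape :: "fm \<Rightarrow> seqt \<Rightarrow> bool" for G :: fm where
  ax_reg: "F \<in> VarsBot \<Longrightarrow> axiom_shape G (Reg (GammaAt G - {F}) F)"
| ax_irr: "F \<in> VarsBot \<Longrightarrow> axiom_shape G (Irr {} ((GammaAt G - {F}) \<union> GammaImp G) F)"

inductive unary_shape :: "fm \<Rightarrow> seqt \<Rightarrow> seqt \<Rightarrow> bool" for G :: fm where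
  and1_reg: "unary_shape G (Reg \<Gamma> A) (Reg \<Gamma> (And A B))"
| and2_reg: "unary_shape G (Reg \<Gamma> B) (Reg \<Gamma> (And A B))"
| and1_irr: "unary_shape G (Irr \<Sigma> \<Theta> A) (Irr \<Sigma> \<Theta> (And A B))"
| and2_irr: "unary_shape G (Irr \<Sigma> \<Theta> B) (Irr \<Sigma> \<Theta> (And A B))"
| imp_in_reg: "A \<in> Cl \<Gamma> \<Longrightarrow> unary_shape G (Reg \<Gamma> B) (Reg \<Gamma> (Imp A B))"
| imp_in_irr:
    "\<Theta> \<inter> \<Lambda> = {} \<Longrightarrow> A \<in> Cl (\<Sigma> \<union> \<Lambda>) \<Longrightarrow> (\<forall>\<Lambda>'. \<Lambda>' \<subset> \<Lambda> \<longrightarrow> A \<notin> Cl (\<Sigma> \<union> \<Lambda>')) \<Longrightarrow>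
     unary_shape G (Irr \<Sigma> (\<Theta> \<union> \<Lambda>) B) (Irr (\<Sigma> \<union> \<Lambda>) \<Theta> (Imp A B))"
| imp_notin:
    "\<Theta> \<subseteq> Cl \<Gamma> \<inter> GammaBar G \<Longrightarrow> A \<in> Cl \<Gamma> - Cl \<Theta> \<Longrightarrow>
     (\<forall>\<Theta>'. \<Theta> \<subset> \<Theta>' \<and> \<Theta>' \<subseteq> Cl \<Gamma> \<inter> GammaBar G \<longrightarrow> A \<in> Cl \<Theta>') \<Longrightarrow>
     unary_shape G (Reg \<Gamma> B) (Irr {} \<Theta> (Imp A B))"

inductive or_shape :: "seqt \<Rightarrow> seqt \<Rightarrow> seqt \<Rightarrow> bool" where
  or_irr:
    "\<Sigma>1 \<subseteq> \<Sigma>2 \<union> \<Theta>2 \<Longrightarrow> \<Sigma>2 \<subseteq> \<Sigma>1 \<union> \<Theta>1 \<Longrightarrow>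
     or_shape (Irr \<Sigma>1 \<Theta>1 C1) (Irr \<Sigma>2 \<Theta>2 C2) (Irr (\<Sigma>1 \<union> \<Sigma>2) (\<Theta>1 \<inter> \<Theta>2) (Or C1 C2))"

text \<open>The join rules have premises \<open>Irr (\<Sigma> j) (\<Theta> j) (A j)\<close> for \<open>j < n\<close>, indexed from \<open>0\<close>.\<close>

definition join_rhs :: "nat \<Rightarrow> (nat \<Rightarrow> fm) \<Rightarrow> fm set" where
  "join_rhs n A = A ` {..<n}"

definition join_SigmaAt :: "nat \<Rightarrow> (nat \<Rightarrow> fm set) \<Rightarrow> fm set" where
  "join_SigmaAt n \<Sigma> = (\<Union>j<n. \<Sigma> j \<inter> Vars)"

definition join_SigmaImp :: "nat \<Rightarrow> (nat \<Rightarrow> fm set) \<Rightarrow> fm set" where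
  "join_SigmaImp n \<Sigma> = (\<Union>j<n. \<Sigma> j \<inter> Imps)"

definition join_ThetaAt :: "nat \<Rightarrow> (nat \<Rightarrow> fm set) \<Rightarrow> fm set" where
  "join_ThetaAt n \<Theta> = (\<Inter>j<n. \<Theta> j \<inter> Vars)"

definition join_ThetaImp :: "nat \<Rightarrow> (nat \<Rightarrow> fm set) \<Rightarrow> (nat \<Rightarrow> fm) \<Rightarrow> fm set" where
  "join_ThetaImp n \<Theta> A =
     {Imp Y Z | Y Z. Imp Y Z \<in> (\<Inter>j<n. \<Theta> j \<inter> Imps) \<and> Y \<in> join_rhs n A}"

definition join_cond ::
  "nat \<Rightarrow> (nat \<Rightarrow> fm set) \<Rightarrow> (nat \<Rightarrow> fm set) \<Rightarrow> (nat \<Rightarrow> fm) \<Rightarrow> bool" where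
  "join_cond n \<Sigma> \<Theta> A \<longleftrightarrow>
     n \<ge> 1 \<and>
     (\<forall>i<n. \<forall>j<n. i \<noteq> j \<longrightarrow> \<Sigma> i \<subseteq> \<Sigma> j \<union> \<Theta> j) \<and>
     (\<forall>Y Z. Imp Y Z \<in> join_SigmaImp n \<Sigma> \<longrightarrow> Y \<in> join_rhs n A)"

definition join_premises ::
  "nat \<Rightarrow> (nat \<Rightarrow> fm set) \<Rightarrow> (nat \<Rightarrow> fm set) \<Rightarrow> (nat \<Rightarrow> fm) \<Rightarrow> seqt list" where
  "join_premises n \<Sigma> \<Theta> A = map (\<lambda>j. Irr (\<Sigma> j) (\<Theta> j) (A j)) [0..<n]"

inductive join_shape :: "fm \<Rightarrow> seqt list \<Rightarrow> seqt \<Rightarrow> bool" for G :: fm where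
  join_at:
    "join_cond n \<Sigma> \<Theta> A \<Longrightarrow>
     F \<in> VarsBot - join_SigmaAt n \<Sigma> \<Longrightarrow>
     (\<forall>Y \<in> join_rhs n A. \<exists>Z. Imp Y Z \<in> Sl G) \<Longrightarrow>
     join_shape G (join_premises n \<Sigma> \<Theta> A)
       (Reg (join_SigmaAt n \<Sigma> \<union> (join_ThetaAt n \<Theta> - {F}) \<union>
             join_SigmaImp n \<Sigma> \<union> join_ThetaImp n \<Theta> A) F)"
| join_or:
    "join_cond n \<Sigma> \<Theta> A \<Longrightarrow>
     {C1, C2} \<subseteq> join_rhs n A \<Longrightarrow>
     (\<forall>Y \<in> join_rhs n A. \<exists>Z. Imp Y Z \<in> Sl G \<or> Or Y Z \<in> Sr G \<or> Or Z Y \<in> Sr G) \<Longrightarrow>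
     join_shape G (join_premises n \<Sigma> \<Theta> A)
       (Reg (join_SigmaAt n \<Sigma> \<union> join_ThetaAt n \<Theta> \<union>
             join_SigmaImp n \<Sigma> \<union> join_ThetaImp n \<Theta> A) (Or C1 C2))"

definition frj_rule :: "fm \<Rightarrow> seqt list \<Rightarrow> seqt \<Rightarrow> bool" where
  "frj_rule G ps c \<longleftrightarrow>
     (\<forall>s \<in> set ps. is_sequent G s) \<and> is_sequent G c \<and>
     ((ps = [] \<and> axiom_shape G c) \<or>
      (\<exists>p. ps = [p] \<and> unary_shape G p c) \<or>
      (\<exists>p q. ps = [p, q] \<and> or_shape p q c) \<or>
      join_shape G ps c)"

datatype deriv = Node (concl: seqt) (subs: "deriv list")

primrec nodes :: "deriv \<Rightarrow> deriv set" where
  "nodes (Node s ds) = insert (Node s ds) (\<Union> (set (map nodes ds)))"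

definition is_derivation :: "fm \<Rightarrow> deriv \<Rightarrow> bool" where
  "is_derivation G D \<longleftrightarrow> (\<forall>d \<in> nodes D. frj_rule G (map concl (subs d)) (concl d))"

definition derivation_of_goal :: "fm \<Rightarrow> deriv \<Rightarrow> bool" where
  "derivation_of_goal G D \<longleftrightarrow> is_derivation G D \<and> (\<exists>\<Gamma>. concl D = Reg \<Gamma> G)"

definition p_sequents :: "fm \<Rightarrow> deriv \<Rightarrow> seqt set" where
  "p_sequents G D =
     {concl d | d. d \<in> nodes D \<and> (\<exists>\<Gamma> C. concl d = Reg \<Gamma> C) \<and>
        (axiom_shape G (concl d) \<or> join_shape G (map concl (subs d)) (concl d))}"

text \<open>Ranges over all rule instances for \<open>G\<close>, not only those occurring in a given derivation.\<close>

definition mapsto0 :: "fm \<Rightarrow> seqt \<Rightarrow> seqt \<Rightarrow> bool" where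
  "mapsto0 G s1 s2 \<longleftrightarrow> (\<exists>ps. frj_rule G ps s2 \<and> s1 \<in> set ps)"

record 'w kripke =
  worlds :: "'w set"
  acc :: "'w \<Rightarrow> 'w \<Rightarrow> bool"
  root :: 'w
  val :: "'w \<Rightarrow> nat set"

definition kripke_model :: "'w kripke \<Rightarrow> bool" where
  "kripke_model K \<longleftrightarrow>
     reflp_on (worlds K) (acc K) \<and> transp_on (worlds K) (acc K) \<and>
     antisymp_on (worlds K) (acc K) \<and>
     root K \<in> worlds K \<and> (\<forall>w \<in> worlds K. acc K (root K) w) \<and>
     (\<forall>w \<in> worlds K. \<forall>v \<in> worlds K. acc K w v \<longrightarrow> val K w \<subseteq> val K v)"

primrec forces :: "'w kripke \<Rightarrow> 'w \<Rightarrow> fm \<Rightarrow> bool" where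
  "forces K w (Var p) \<longleftrightarrow> p \<in> val K w"
| "forces K w Bot \<longleftrightarrow> False"
| "forces K w (And A B) \<longleftrightarrow> forces K w A \<and> forces K w B"
| "forces K w (Or A B) \<longleftrightarrow> forces K w A \<or> forces K w B"
| "forces K w (Imp A B) \<longleftrightarrow>
     (\<forall>v \<in> worlds K. acc K w v \<longrightarrow> forces K v A \<longrightarrow> forces K v B)"

definition countermodel :: "'w kripke \<Rightarrow> fm \<Rightarrow> bool" where
  "countermodel K A \<longleftrightarrow> kripke_model K \<and> \<not> forces K (root K) A"

text \<open>Premises lie above conclusions in the order.  That the definite description for the root
  is proper is not assumed: \<open>kripke_model\<close> requires \<open>root\<close> to be a least world, and
  antisymmetry makes it unique.\<close>

definition Mod :: "fm \<Rightarrow> deriv \<Rightarrow> seqt kripke" where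
  "Mod G D =
     \<lparr> worlds = p_sequents G D,
       acc = (\<lambda>s1 s2. (mapsto0 G)\<^sup>*\<^sup>* s2 s1),
       root = (THE r. r \<in> p_sequents G D \<and> (\<forall>s \<in> p_sequents G D. (mapsto0 G)\<^sup>*\<^sup>* s r)),
       val = (\<lambda>s. {p. Var p \<in> Lhs s}) \<rparr>"

end

theory Submission
  imports Defs
begin

text \<open>Along \<open>mapsto0\<close> the closure of the left-hand side can only shrink, and it shrinks strictly
  at the rule \<open>imp_notin\<close>, the only one leading from regular to irregular sequents. Steps between
  regular sequents enlarge the right formula. Hence distinct regular sequents never lie on a common
  cycle, even though \<open>mapsto0\<close> ranges over all rule instances, and the order of the model is
  antisymmetric. By induction along this order, every world forces its left-hand side and refutes
  its right formula. At a world obtained by a join this needs that the right formulas of the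
  premises are refuted, which is shown by induction on their size: deciding \<open>A \<in> Cl \<Gamma>\<close> only involves
  the members of \<open>\<Gamma>\<close> no larger than \<open>A\<close>.\<close>

section \<open>Closure and intuitionistic forcing\<close>

lemma Cl_subset:
  assumes "X \<subseteq> Cl Y"
  shows "Cl X \<subseteq> Cl Y"
proof
  fix A assume "A \<in> Cl X"
  then show "A \<in> Cl Y"
    by induction (use assms in \<open>auto intro: Cl.intros\<close>)
qed

lemma Var_in_Cl_iff [simp]: "Var p \<in> Cl \<Gamma> \<longleftrightarrow> Var p \<in> \<Gamma>"
  by (auto intro: Cl_base elim: Cl.cases)

lemma forces_mono:
  assumes "kripke_model K" "w \<in> worlds K" "v \<in> worlds K" "acc K w v" "forces K w A"
  shows "forces K v A"
  using assms
proof (induction A arbitrary: w v)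
  case (Imp A B)
  have "transp_on (worlds K) (acc K)"
    using Imp.prems(1) by (simp add: kripke_model_def)
  then have "acc K w u" if "u \<in> worlds K" "acc K v u" for u
    using Imp.prems that by (blast dest: transp_onD)
  then show ?case
    using Imp.prems by auto
qed (auto simp: kripke_model_def)

text \<open>Every closure rule yields a larger formula, so only members of \<open>\<Gamma>\<close>
  of size at most that of \<open>A\<close> can occur in building \<open>A\<close>;
  \<open>Cl_Imp\<close> is handled by persistence. The size bound is what later allows induction on
  the size of right formulas while larger members of a left-hand side are still undecided.\<close>

lemma forces_Cl:
  assumes "kripke_model K" "w \<in> worlds K" "A \<in> Cl \<Gamma>"
    and "\<And>H. H \<in> \<Gamma> \<Longrightarrow> size H \<le> size A \<Longrightarrow> forces K w H"
  shows "forces K w A"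
  using assms(3,4)
proof induction
  case (Cl_Imp X A)
  then have "forces K w X"
    by simp
  then show ?case
    using assms(1,2) forces_mono by auto
qed auto

section \<open>Inversion of the rules\<close>

text \<open>Common interface to both join rules. Compatibility of the premises puts each
  \<open>\<Sigma> i\<close> inside \<open>\<Sigma> j \<union> \<Theta> j\<close>, and the
  \<open>\<Theta>\<close> parts are intersections, so the new left-hand side is squeezed between
  \<open>\<Sigma>\<close> and \<open>\<Sigma> \<union> \<Theta>\<close> of every premise. That
  premises are sequents ensures that splitting \<open>\<Sigma> j\<close> into variables and
  implications loses nothing.\<close>

lemma join_shapeE:
  assumes "join_shape G ps s" "\<forall>p \<in> set ps. is_sequent G p"
  obtains \<Gamma> C where "s = Reg \<Gamma> C"
    "\<forall>p \<in> set ps. \<exists>\<Sigma> \<Theta> Y. p = Irr \<Sigma> \<Theta> Y \<and> \<Sigma> \<subseteq> \<Gamma> \<and> \<Gamma> \<subseteq> \<Sigma> \<union> \<Theta>"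
    "\<forall>Y Z. Imp Y Z \<in> \<Gamma> \<longrightarrow> Y \<in> Rhs ` set ps"
    "C \<in> VarsBot \<and> C \<notin> \<Gamma> \<or> (\<exists>C1 C2. C = Or C1 C2 \<and> {C1, C2} \<subseteq> Rhs ` set ps)"
proof -
  have rhs: "Rhs ` set (join_premises n \<Sigma> \<Theta> A) = join_rhs n A" for n \<Sigma> \<Theta> A
    by (force simp: join_premises_def join_rhs_def)
  obtain n \<Sigma> \<Theta> A \<Gamma> C where s: "s = Reg \<Gamma> C" and ps: "ps = join_premises n \<Sigma> \<Theta> A"
    and cond: "join_cond n \<Sigma> \<Theta> A"
    and lower: "join_SigmaAt n \<Sigma> \<union> join_SigmaImp n \<Sigma> \<subseteq> \<Gamma>"
    and upper: "\<Gamma> \<subseteq> join_SigmaAt n \<Sigma> \<union> join_ThetaAt n \<Theta> \<union> join_SigmaImp n \<Sigma> \<union> join_ThetaImp n \<Theta> A"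
    and C: "C \<in> VarsBot \<and> C \<notin> \<Gamma> \<or> (\<exists>C1 C2. C = Or C1 C2 \<and> {C1, C2} \<subseteq> join_rhs n A)"
    using assms(1)
  proof cases
    case (join_at n \<Sigma> \<Theta> A F)
    \<comment> \<open>The rule removes \<open>F\<close> from the atomic \<open>\<Theta>\<close> part
      and its side condition keeps it out of the atomic \<open>\<Sigma>\<close> part; only the
      implicational parts remain to be checked.\<close>
    have "F \<notin> join_SigmaImp n \<Sigma> \<union> join_ThetaImp n \<Theta> A"
      using join_at(4)
      by (auto simp: join_SigmaImp_def join_ThetaImp_def Imps_def VarsBot_def Vars_def)
    then show thesis
      using join_at by (intro that[OF join_at(2,1,3)]) auto
  next
    case (join_or n \<Sigma> \<Theta> A C1 C2)
    show thesis
      using join_or(4) by (intro that[OF join_or(2,1,3)]) auto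
  qed
  \<comment> \<open>With no premises the intersection in \<open>join_ThetaAt\<close> would be
    \<open>UNIV\<close>; positivity of \<open>n\<close> makes it a set of variables.\<close>
  have "0 < n"
    using cond by (simp add: join_cond_def)
  show thesis
  proof (rule that[OF s]; (intro ballI allI impI)?)
    fix p assume "p \<in> set ps"
    then obtain j where j: "j < n" "p = Irr (\<Sigma> j) (\<Theta> j) (A j)"
      by (auto simp: ps join_premises_def)
    have "is_sequent G p"
      using assms(2) \<open>p \<in> set ps\<close> by blast
    then have "\<Sigma> j \<subseteq> Vars \<union> Imps"
      by (auto simp: j(2) is_sequent_def GammaBar_def GammaAt_def GammaImp_def)
    moreover have "\<Sigma> j \<inter> Vars \<subseteq> join_SigmaAt n \<Sigma>" "\<Sigma> j \<inter> Imps \<subseteq> join_SigmaImp n \<Sigma>"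
      using j(1) by (auto simp: join_SigmaAt_def join_SigmaImp_def)
    ultimately have "\<Sigma> j \<subseteq> \<Gamma>"
      using lower by blast
    moreover have "\<Sigma> i \<subseteq> \<Sigma> j \<union> \<Theta> j" if "i < n" for i
      using cond j(1) that by (cases "i = j") (simp_all add: join_cond_def)
    then have "join_SigmaAt n \<Sigma> \<subseteq> \<Sigma> j \<union> \<Theta> j" "join_SigmaImp n \<Sigma> \<subseteq> \<Sigma> j \<union> \<Theta> j"
      "join_ThetaAt n \<Theta> \<subseteq> \<Sigma> j \<union> \<Theta> j" "join_ThetaImp n \<Theta> A \<subseteq> \<Sigma> j \<union> \<Theta> j"
      using j(1) by (auto simp: join_SigmaAt_def join_SigmaImp_def join_ThetaAt_def join_ThetaImp_def)
    then have "\<Gamma> \<subseteq> \<Sigma> j \<union> \<Theta> j"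
      using upper by blast
    ultimately show "\<exists>\<Sigma>' \<Theta>' Y. p = Irr \<Sigma>' \<Theta>' Y \<and> \<Sigma>' \<subseteq> \<Gamma> \<and> \<Gamma> \<subseteq> \<Sigma>' \<union> \<Theta>'"
      using j(2) by blast
  next
    fix Y Z assume "Imp Y Z \<in> \<Gamma>"
    moreover have "Imp Y Z \<notin> join_SigmaAt n \<Sigma> \<union> join_ThetaAt n \<Theta>"
      using \<open>0 < n\<close> by (auto simp: join_SigmaAt_def join_ThetaAt_def Vars_def)
    ultimately have "Imp Y Z \<in> join_SigmaImp n \<Sigma> \<union> join_ThetaImp n \<Theta> A"
      using upper by blast
    then have "Y \<in> join_rhs n A"
      using cond by (auto simp: join_cond_def join_ThetaImp_def)
    then show "Y \<in> Rhs ` set ps"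
      by (simp add: ps rhs)
  qed (use C ps rhs in simp)
qed

lemma join_shape_premises_irregular:
  assumes "join_shape G ps s" "\<forall>p \<in> set ps. is_sequent G p"
  shows "Reg \<Gamma> C \<notin> set ps"
proof
  assume C: "Reg \<Gamma> C \<in> set ps"
  obtain \<Gamma>' where "\<forall>p \<in> set ps. \<exists>\<Sigma> \<Theta> Y. p = Irr \<Sigma> \<Theta> Y \<and> \<Sigma> \<subseteq> \<Gamma>' \<and> \<Gamma>' \<subseteq> \<Sigma> \<union> \<Theta>"
    using assms by (elim join_shapeE)
  then show False
    using C by fastforce
qed

lemma unary_shape_Reg:
  assumes "unary_shape G p (Reg \<Gamma> C)"
  obtains B where "p = Reg \<Gamma> B" "C \<notin> VarsBot"
  using assms by cases (auto simp: VarsBot_def Vars_def)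

text \<open>For an implication the world \<open>w\<close> is its own counterexample: it forces the
  antecedent, which lies in the closure of \<open>\<Gamma>\<close>, and refutes the
  consequent.\<close>

lemma unary_shape_refutes:
  assumes "unary_shape G (Reg \<Gamma> B) (Reg \<Gamma> C)" and K: "kripke_model K" "w \<in> worlds K"
    and "\<forall>H \<in> \<Gamma>. forces K w H" "\<not> forces K w B"
  shows "\<not> forces K w C"
  using assms(1)
proof cases
  case (imp_in_reg A)
  have "acc K w w"
    using K by (auto simp: kripke_model_def dest: reflp_onD)
  moreover have "forces K w A"
    using forces_Cl[OF K] assms(4) imp_in_reg by blast
  ultimately show ?thesis
    using K(2) assms(5) imp_in_reg by auto
qed (use assms(5) in auto)

lemma frj_rule_cases [consumes 1, case_names axiom unary disj join]:
  assumes "frj_rule G ps s"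
  obtains "ps = []" "axiom_shape G s"
  | p where "ps = [p]" "unary_shape G p s"
  | p q where "ps = [p, q]" "or_shape p q s"
  | "join_shape G ps s" "\<forall>p \<in> set ps. is_sequent G p"
  using assms by (auto simp: frj_rule_def)

section \<open>Monotonicity of closures and antisymmetry of the order\<close>

text \<open>Apart from \<open>imp_notin\<close>, each rule with premises has a conclusion whose
  left-hand side is contained in that of every premise; \<open>imp_notin\<close> guarantees
  containment in the closure only, which is why the order is compared through
  \<open>Cl\<close>.\<close>

lemma mapsto0_Cl_Lhs:
  assumes "mapsto0 G s t"
  shows "Cl (Lhs t) \<subseteq> Cl (Lhs s)"
proof (rule Cl_subset)
  obtain ps where ps: "frj_rule G ps t" "s \<in> set ps"
    using assms by (auto simp: mapsto0_def)
  from ps(1) show "Lhs t \<subseteq> Cl (Lhs s)"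
  proof (cases rule: frj_rule_cases)
    case (unary p)
    then show ?thesis
      using ps(2) by (auto elim!: unary_shape.cases intro: Cl_base)
  next
    case (disj p q)
    then have "Lhs t \<subseteq> Lhs s"
      using ps(2) by (auto elim!: or_shape.cases)
    then show ?thesis
      by (auto intro: Cl_base)
  next
    case join
    then obtain \<Gamma> C where \<Gamma>: "t = Reg \<Gamma> C"
      "\<forall>p \<in> set ps. \<exists>\<Sigma> \<Theta> Y. p = Irr \<Sigma> \<Theta> Y \<and> \<Sigma> \<subseteq> \<Gamma> \<and> \<Gamma> \<subseteq> \<Sigma> \<union> \<Theta>"
      by (elim join_shapeE)
    have "\<Gamma> \<subseteq> Lhs s"
      using \<Gamma>(2) ps(2) by fastforce
    then show ?thesis
      using \<Gamma>(1) by (auto intro: Cl_base)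
  qed (use ps(2) in simp)
qed

lemma mapsto_Cl_Lhs: "(mapsto0 G)\<^sup>*\<^sup>* s t \<Longrightarrow> Cl (Lhs t) \<subseteq> Cl (Lhs s)"
  by (induction rule: rtranclp_induct) (auto dest!: mapsto0_Cl_Lhs)

text \<open>A regular premise occurs only in unary rules. The hypothesis on closures excludes
  \<open>imp_notin\<close>, whose antecedent lies in \<open>Cl \<Gamma>\<close> but not in the
  closure of the new left-hand side. The remaining rules keep \<open>\<Gamma>\<close> and build a
  larger right formula.\<close>

lemma mapsto0_Reg_strict:
  assumes "mapsto0 G (Reg \<Gamma> C) t" "Cl \<Gamma> \<subseteq> Cl (Lhs t)"
  obtains C' where "t = Reg \<Gamma> C'" "size C < size C'"
proof -
  obtain ps where ps: "frj_rule G ps t" "Reg \<Gamma> C \<in> set ps"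
    using assms(1) by (auto simp: mapsto0_def)
  from ps(1) show thesis
  proof (cases rule: frj_rule_cases)
    case (unary p)
    then have "unary_shape G (Reg \<Gamma> C) t"
      using ps(2) by simp
    then show thesis
      by cases (use that assms(2) in auto)
  next
    case (disj p q)
    then show thesis
      using ps(2) by (auto elim!: or_shape.cases)
  next
    case join
    then show thesis
      using ps(2) join_shape_premises_irregular by blast
  qed (use ps(2) in simp)
qed

lemma mapsto_Reg_strict:
  assumes "(mapsto0 G)\<^sup>*\<^sup>* (Reg \<Gamma> C) t" "Cl \<Gamma> \<subseteq> Cl (Lhs t)"
  shows "t = Reg \<Gamma> C \<or> (\<exists>C'. t = Reg \<Gamma> C' \<and> size C < size C')"
  using assms
proof (induction rule: rtranclp_induct)
  case (step t u)
  \<comment> \<open>Since closures shrink along the path, the bound at its end also holds at every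
    earlier sequent.\<close>
  then have "Cl \<Gamma> \<subseteq> Cl (Lhs t)"
    using mapsto0_Cl_Lhs by blast
  with step obtain C' where t: "t = Reg \<Gamma> C'" "size C \<le> size C'"
    by auto
  obtain C'' where "u = Reg \<Gamma> C''" "size C' < size C''"
    using step t mapsto0_Reg_strict by metis
  then show ?case
    using t by auto
qed simp

text \<open>Mutual reachability equalizes the closures, so strict growth applies in both directions;
  distinct sequents would each need the larger right formula.\<close>

lemma mapsto_antisym:
  assumes "(mapsto0 G)\<^sup>*\<^sup>* (Reg \<Gamma> C) (Reg \<Gamma>' C')" "(mapsto0 G)\<^sup>*\<^sup>* (Reg \<Gamma>' C') (Reg \<Gamma> C)"
  shows "Reg \<Gamma> C = Reg \<Gamma>' C'"
proof -
  have "Cl \<Gamma> = Cl \<Gamma>'"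
    using assms[THEN mapsto_Cl_Lhs] by auto
  then show ?thesis
    using assms[THEN mapsto_Reg_strict] by auto
qed

section \<open>Derivation trees and their p-sequents\<close>

lemma nodes_refl [simp]: "d \<in> nodes d"
  by (cases d) simp

lemma nodes_trans: "e \<in> nodes d \<Longrightarrow> d \<in> nodes D \<Longrightarrow> e \<in> nodes D"
  by (induction D) auto

lemma subs_subset_nodes: "e \<in> set (subs d) \<Longrightarrow> e \<in> nodes d"
  by (cases d) (auto intro: bexI[of _ e])

lemma finite_nodes: "finite (nodes D)"
  by (induction D) auto

lemma is_derivation_node: "is_derivation G D \<Longrightarrow> d \<in> nodes D \<Longrightarrow> is_derivation G d"
  by (auto simp: is_derivation_def intro: nodes_trans)

lemma is_derivation_rule:
  "is_derivation G D \<Longrightarrow> d \<in> nodes D \<Longrightarrow> frj_rule G (map concl (subs d)) (concl d)"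
  by (simp add: is_derivation_def)

lemma subs_mapsto0:
  assumes "is_derivation G D" "e \<in> set (subs D)"
  shows "mapsto0 G (concl e) (concl D)"
  unfolding mapsto0_def using is_derivation_rule[OF assms(1) nodes_refl] assms(2) by auto

lemma nodes_mapsto:
  assumes "is_derivation G D" "d \<in> nodes D"
  shows "(mapsto0 G)\<^sup>*\<^sup>* (concl d) (concl D)"
  using assms
proof (induction D)
  case (Node s ds)
  show ?case
  proof (cases "d = Node s ds")
    case False
    then obtain e where e: "e \<in> set ds" "d \<in> nodes e"
      using Node.prems(2) by auto
    then have "is_derivation G e"
      using Node.prems(1) subs_subset_nodes[of e "Node s ds"] is_derivation_node by auto
    then have "(mapsto0 G)\<^sup>*\<^sup>* (concl d) (concl e)"
      using Node.IH e by blast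
    then show ?thesis
      using subs_mapsto0[OF Node.prems(1)] e(1) by (simp add: rtranclp.rtrancl_into_rtrancl)
  qed simp
qed

lemma p_sequents_mapsto:
  assumes "is_derivation G D" "s \<in> p_sequents G D"
  shows "(mapsto0 G)\<^sup>*\<^sup>* s (concl D)"
proof -
  obtain d where "d \<in> nodes D" "s = concl d"
    using assms(2) unfolding p_sequents_def by blast
  then show ?thesis
    using nodes_mapsto assms(1) by blast
qed

lemma finite_p_sequents: "finite (p_sequents G D)"
  by (rule finite_subset[of _ "concl ` nodes D"]) (auto simp: p_sequents_def finite_nodes)

lemma p_sequents_mono: "d \<in> nodes D \<Longrightarrow> p_sequents G d \<subseteq> p_sequents G D"
  by (auto simp: p_sequents_def intro: nodes_trans)

text \<open>Between a regular sequent and the p-sequent above it there are only regular instances of the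
  rules for \<open>And\<close> and \<open>Imp\<close>, which keep the left-hand side and preserve refutation at any
  world that forces it.\<close>

lemma regular_top:
  assumes "is_derivation G D" "concl D = Reg \<Gamma> C"
  obtains C' where "Reg \<Gamma> C' \<in> p_sequents G D"
    "\<forall>s \<in> p_sequents G D. (mapsto0 G)\<^sup>*\<^sup>* s (Reg \<Gamma> C')"
    "\<forall>(K :: 'a kripke) w. kripke_model K \<longrightarrow> w \<in> worlds K \<longrightarrow> (\<forall>H \<in> \<Gamma>. forces K w H) \<longrightarrow>
      \<not> forces K w C' \<longrightarrow> \<not> forces K w C"
proof -
  \<comment> \<open>The model \<open>K\<close> is quantified because the result is applied to
    subderivations while forcing is evaluated in the model of the whole derivation.\<close>
  have "\<exists>C'. Reg \<Gamma> C' \<in> p_sequents G D \<and>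
      (\<forall>s \<in> p_sequents G D. (mapsto0 G)\<^sup>*\<^sup>* s (Reg \<Gamma> C')) \<and>
      (\<forall>(K :: 'a kripke) w. kripke_model K \<longrightarrow> w \<in> worlds K \<longrightarrow> (\<forall>H \<in> \<Gamma>. forces K w H) \<longrightarrow>
        \<not> forces K w C' \<longrightarrow> \<not> forces K w C)"
    using assms
  proof (induction D arbitrary: C)
    case (Node s ds)
    have s: "s = Reg \<Gamma> C"
      using Node.prems(2) by simp
    have below: "(mapsto0 G)\<^sup>*\<^sup>* t s" if "t \<in> p_sequents G (Node s ds)" for t
      using p_sequents_mapsto[OF Node.prems(1) that] by simp
    have rule: "frj_rule G (map concl ds) s"
      using is_derivation_rule[OF Node.prems(1) nodes_refl] by simp
    have top: ?case if "axiom_shape G s \<or> join_shape G (map concl ds) s"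
    proof -
      have "s \<in> p_sequents G (Node s ds)"
        unfolding p_sequents_def mem_Collect_eq using s that by (intro exI[of _ "Node s ds"]) simp
      then show ?thesis
        using below s by (intro exI[of _ C]) simp
    qed
    from rule show ?case
    proof (cases rule: frj_rule_cases)
      case axiom
      then show ?thesis
        using top by blast
    next
      case (unary p)
      then obtain d where d: "ds = [d]" "concl d = p"
        by auto
      have der: "is_derivation G d"
        using is_derivation_node[OF Node.prems(1)] d by simp
      obtain B where B: "p = Reg \<Gamma> B" "C \<notin> VarsBot"
        using unary(2) unary_shape_Reg s by blast
      \<comment> \<open>A compound right formula excludes axioms and a regular premise excludes
        joins, so the conclusion contributes no new p-sequent and the witness for the premise serves
        again.\<close>
      have "\<not> axiom_shape G s"
        using B(2) s by (auto elim!: axiom_shape.cases)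
      moreover have "\<not> join_shape G (map concl ds) s"
        using rule d B(1) join_shape_premises_irregular[of G "map concl ds" s \<Gamma> B]
        by (auto simp: frj_rule_def)
      ultimately have "p_sequents G (Node s ds) \<subseteq> p_sequents G d"
        using d by (auto simp: p_sequents_def)
      moreover have "p_sequents G d \<subseteq> p_sequents G (Node s ds)"
        using d by (intro p_sequents_mono) auto
      ultimately have eq: "p_sequents G (Node s ds) = p_sequents G d"
        by blast
      have step: "unary_shape G (Reg \<Gamma> B) (Reg \<Gamma> C)"
        using unary(2) B(1) s by simp
      have "d \<in> set ds" "concl d = Reg \<Gamma> B"
        using d B(1) by auto
      then obtain C' where C': "Reg \<Gamma> C' \<in> p_sequents G d"
        "\<forall>s \<in> p_sequents G d. (mapsto0 G)\<^sup>*\<^sup>* s (Reg \<Gamma> C')"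
        "\<forall>(K :: 'a kripke) w. kripke_model K \<longrightarrow> w \<in> worlds K \<longrightarrow> (\<forall>H \<in> \<Gamma>. forces K w H) \<longrightarrow>
          \<not> forces K w C' \<longrightarrow> \<not> forces K w B"
        using Node.IH[OF _ der] by blast
      have "\<forall>(K :: 'a kripke) w. kripke_model K \<longrightarrow> w \<in> worlds K \<longrightarrow> (\<forall>H \<in> \<Gamma>. forces K w H) \<longrightarrow>
          \<not> forces K w C' \<longrightarrow> \<not> forces K w C"
        by (intro allI impI, rule unary_shape_refutes[OF step]) (use C'(3) in simp_all)
      then show ?thesis
        unfolding eq using C'(1,2) by blast
    next
      case (disj p q)
      from disj(2) show ?thesis
        unfolding s by cases
    next
      case join
      then show ?thesis
        using top by blast
    qed
  qed
  then show thesis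
    using that by blast
qed

section \<open>The Kripke model of a derivation\<close>

lemma Mod_simps [simp]:
  "worlds (Mod G D) = p_sequents G D"
  "acc (Mod G D) s t \<longleftrightarrow> (mapsto0 G)\<^sup>*\<^sup>* t s"
  "p \<in> val (Mod G D) s \<longleftrightarrow> Var p \<in> Lhs s"
  by (simp_all add: Mod_def)

lemma p_sequents_antisym:
  assumes "s \<in> p_sequents G D" "t \<in> p_sequents G D" "(mapsto0 G)\<^sup>*\<^sup>* s t" "(mapsto0 G)\<^sup>*\<^sup>* t s"
  shows "s = t"
proof -
  obtain \<Gamma> C \<Gamma>' C' where "s = Reg \<Gamma> C" "t = Reg \<Gamma>' C'"
    using assms(1,2) by (auto simp: p_sequents_def)
  then show ?thesis
    using assms(3,4) mapsto_antisym by blast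
qed

lemma root_Mod:
  assumes "r \<in> p_sequents G D" "\<forall>s \<in> p_sequents G D. (mapsto0 G)\<^sup>*\<^sup>* s r"
  shows "root (Mod G D) = r"
  unfolding Mod_def using assms by (auto intro!: the_equality p_sequents_antisym)

lemma kripke_model_Mod:
  assumes "r \<in> p_sequents G D" "\<forall>s \<in> p_sequents G D. (mapsto0 G)\<^sup>*\<^sup>* s r"
  shows "kripke_model (Mod G D)"
proof -
  \<comment> \<open>Persistence passes through closures: no closure rule creates a variable, so a
    variable in the larger closure is already in the left-hand side.\<close>
  have "val (Mod G D) w \<subseteq> val (Mod G D) v" if "(mapsto0 G)\<^sup>*\<^sup>* v w" for v w
  proof
    fix p assume "p \<in> val (Mod G D) w"
    then have "Var p \<in> Cl (Lhs w)"
      by simp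
    then have "Var p \<in> Cl (Lhs v)"
      using mapsto_Cl_Lhs[OF that] by blast
    then show "p \<in> val (Mod G D) v"
      by simp
  qed
  moreover have "root (Mod G D) = r"
    using assms by (rule root_Mod)
  ultimately show ?thesis
    unfolding kripke_model_def using assms p_sequents_antisym
    by (auto intro!: reflp_onI transp_onI antisymp_onI)
qed

section \<open>Forcing of left-hand sides and refutation of right formulas\<close>

text \<open>Descends from a premise of the join at \<open>w\<close> into its subderivation. The
  bounds \<open>\<Sigma> \<subseteq> Lhs w \<subseteq> \<Sigma> \<union> \<Theta>\<close> pass to
  irregular premises. The upper bound settles axioms, since it keeps \<open>F\<close> out of
  \<open>Lhs w\<close>; the lower one settles \<open>imp_in_irr\<close>, where the antecedent is in
  \<open>Cl \<Sigma>\<close> and smaller than \<open>C\<close>. At \<open>imp_notin\<close> a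
  strictly higher world is used, covered by the hypothesis \<open>above\<close>.\<close>

lemma irregular_refuted:
  assumes "is_derivation G D" and K: "kripke_model (Mod G D)"
    and w: "w \<in> p_sequents G D"
    and above: "\<And>v. v \<in> p_sequents G D \<Longrightarrow> (mapsto0 G)\<^sup>*\<^sup>* v w \<Longrightarrow> v \<noteq> w \<Longrightarrow>
      (\<forall>H \<in> Lhs v. forces (Mod G D) v H) \<and> \<not> forces (Mod G D) v (Rhs v)"
    and "d \<in> nodes D" "concl d = Irr \<Sigma> \<Theta> C" "(mapsto0 G)\<^sup>*\<^sup>* (concl d) w"
    and "\<Sigma> \<subseteq> Lhs w" "Lhs w \<subseteq> \<Sigma> \<union> \<Theta>"
    and "\<And>H. H \<in> Lhs w \<Longrightarrow> size H < size C \<Longrightarrow> forces (Mod G D) w H"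
  shows "\<not> forces (Mod G D) w C"
  using assms(5-)
proof (induction d arbitrary: \<Sigma> \<Theta> C)
  case (Node s ds)
  have s: "s = Irr \<Sigma> \<Theta> C"
    using Node.prems(2) by simp
  have der: "is_derivation G (Node s ds)"
    using is_derivation_node assms(1) Node.prems(1) by blast
  have sub: "d \<in> nodes D" "(mapsto0 G)\<^sup>*\<^sup>* (concl d) w" if "d \<in> set ds" for d
  proof -
    show "d \<in> nodes D"
      using nodes_trans[OF subs_subset_nodes Node.prems(1)] that by simp
    show "(mapsto0 G)\<^sup>*\<^sup>* (concl d) w"
      using subs_mapsto0[OF der, of d] that Node.prems(3)
      by (simp add: converse_rtranclp_into_rtranclp)
  qed
  have refl: "acc (Mod G D) w w"
    by simp
  have rule: "frj_rule G (map concl ds) s"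
    using is_derivation_rule[OF der nodes_refl] by simp
  from rule show ?case
  proof (cases rule: frj_rule_cases)
    case axiom
    from axiom(2) show ?thesis
      unfolding s by cases (use Node.prems(4,5) in \<open>auto simp: VarsBot_def Vars_def GammaImp_def Imps_def\<close>)
  next
    case (unary p)
    then obtain d where d: "d \<in> set ds" "concl d = p"
      by auto
    have IH: "\<not> forces (Mod G D) w B" if "p = Irr \<Sigma>' \<Theta>' B" "\<Sigma>' \<subseteq> \<Sigma>" "\<Sigma> \<union> \<Theta> \<subseteq> \<Sigma>' \<union> \<Theta>'"
      "size B < size C" for \<Sigma>' \<Theta>' B
      by (rule Node.IH[OF d(1) sub(1)[OF d(1)] _ sub(2)[OF d(1)], of \<Sigma>' \<Theta>'])
        (use that d Node.prems(4-) in auto)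
    from unary(2) show ?thesis
      unfolding s
    proof cases
      case (and1_irr A B)
      then show ?thesis
        using IH by auto
    next
      case (and2_irr B A)
      then show ?thesis
        using IH by auto
    next
      case (imp_in_irr \<Lambda> A \<Sigma>' B)
      then have "A \<in> Cl \<Sigma>" "C = Imp A B"
        by simp_all
      then have "forces (Mod G D) w A"
        using w Node.prems(4,6) by (intro forces_Cl[OF K, of w A \<Sigma>]) auto
      moreover have "\<not> forces (Mod G D) w B"
        using imp_in_irr by (intro IH[of \<Sigma>' "\<Theta> \<union> \<Lambda>"]) auto
      ultimately show ?thesis
        using imp_in_irr w refl by auto
    next
      case (imp_notin \<Gamma> A B)
      have "d \<in> nodes D"
        using sub(1) d by blast
      then have "is_derivation G d"
        using assms(1) is_derivation_node by blast
      then obtain C' where C': "Reg \<Gamma> C' \<in> p_sequents G d"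
        "\<forall>K (v :: seqt). kripke_model K \<longrightarrow> v \<in> worlds K \<longrightarrow> (\<forall>H \<in> \<Gamma>. forces K v H) \<longrightarrow>
          \<not> forces K v C' \<longrightarrow> \<not> forces K v B"
        using d(2) imp_notin by (elim regular_top[of G d \<Gamma> B]) auto
      define v where "v = Reg \<Gamma> C'"
      have v: "v \<in> p_sequents G D" "(mapsto0 G)\<^sup>*\<^sup>* v w"
      proof -
        show "v \<in> p_sequents G D"
          using C'(1) p_sequents_mono \<open>d \<in> nodes D\<close> v_def by blast
        have "(mapsto0 G)\<^sup>*\<^sup>* v (concl d)"
          using p_sequents_mapsto[OF \<open>is_derivation G d\<close> C'(1)] by (simp add: v_def)
        then show "(mapsto0 G)\<^sup>*\<^sup>* v w"
          using sub(2)[OF d(1)] by (rule rtranclp_trans)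
      qed
      \<comment> \<open>The antecedent \<open>A\<close> is in \<open>Cl \<Gamma>\<close> but not in
        \<open>Cl \<Theta>\<close>, hence not in \<open>Cl (Lhs w)\<close>. This separates the
        witness \<open>v\<close> from \<open>w\<close>.\<close>
      have "Cl (Lhs w) \<subseteq> Cl \<Theta>"
        using mapsto_Cl_Lhs[OF Node.prems(3)] s imp_notin by simp
      then have "v \<noteq> w"
        using imp_notin by (auto simp: v_def)
      then have "\<forall>H \<in> \<Gamma>. forces (Mod G D) v H" "\<not> forces (Mod G D) v C'"
        using above[OF v] by (auto simp: v_def)
      then have "forces (Mod G D) v A" "\<not> forces (Mod G D) v B"
        using C'(2) K forces_Cl[OF K, of v A \<Gamma>] v(1) imp_notin by auto
      then show ?thesis
        using imp_notin v by auto
    qed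
  next
    case (disj p q)
    then obtain dp dq where ds: "ds = [dp, dq]" "concl dp = p" "concl dq = q"
      by auto
    have IH: "\<not> forces (Mod G D) w B" if "d \<in> set ds" "concl d = Irr \<Sigma>' \<Theta>' B" "\<Sigma>' \<subseteq> \<Sigma>"
      "\<Sigma> \<union> \<Theta> \<subseteq> \<Sigma>' \<union> \<Theta>'" "size B < size C" for d \<Sigma>' \<Theta>' B
      by (rule Node.IH[OF that(1) sub(1)[OF that(1)] that(2) sub(2)[OF that(1)]])
        (use that Node.prems(4-) in auto)
    from disj(2) show ?thesis
      unfolding s
    proof cases
      case (or_irr \<Sigma>1 \<Sigma>2 \<Theta>2 \<Theta>1 C1 C2)
      have "\<not> forces (Mod G D) w C1"
        using or_irr ds by (intro IH[of dp \<Sigma>1 \<Theta>1]) auto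
      moreover have "\<not> forces (Mod G D) w C2"
        using or_irr ds by (intro IH[of dq \<Sigma>2 \<Theta>2]) auto
      ultimately show ?thesis
        using or_irr by simp
    qed
  next
    case join
    then show ?thesis
      using s by (elim join_shapeE) auto
  qed
qed

text \<open>Induction on the number of worlds above \<open>w\<close>. Axioms have only variables on
  the left and omit their right formula, so they are immediate; at a join, forcing of members and
  refutation of premises support each other through formula size.\<close>

lemma world_realizes:
  assumes "is_derivation G D" and K: "kripke_model (Mod G D)"
  shows "w \<in> p_sequents G D \<Longrightarrow>
    (\<forall>H \<in> Lhs w. forces (Mod G D) w H) \<and> \<not> forces (Mod G D) w (Rhs w)"
proof (induction "card {v \<in> p_sequents G D. (mapsto0 G)\<^sup>*\<^sup>* v w}" arbitrary: w rule: less_induct)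
  case less
  have above: "(\<forall>H \<in> Lhs v. forces (Mod G D) v H) \<and> \<not> forces (Mod G D) v (Rhs v)"
    if v: "v \<in> p_sequents G D" "(mapsto0 G)\<^sup>*\<^sup>* v w" "v \<noteq> w" for v
  proof (rule less.hyps[OF _ v(1)], rule psubset_card_mono)
    \<comment> \<open>The world \<open>w\<close> is above itself but not above \<open>v\<close>, so
      the count drops.\<close>
    have "\<not> (mapsto0 G)\<^sup>*\<^sup>* w v"
      using v less.prems p_sequents_antisym by blast
    then show "{u \<in> p_sequents G D. (mapsto0 G)\<^sup>*\<^sup>* u v} \<subset> {u \<in> p_sequents G D. (mapsto0 G)\<^sup>*\<^sup>* u w}"
      using v(2) less.prems by auto
  qed (simp add: finite_p_sequents)
  obtain d where d: "d \<in> nodes D" "concl d = w"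
    "axiom_shape G w \<or> join_shape G (map concl (subs d)) w"
    and reg: "\<exists>\<Gamma> C. w = Reg \<Gamma> C"
    using less.prems by (auto simp: p_sequents_def)
  have "is_derivation G d"
    using assms(1) d(1) is_derivation_node by blast
  have rule: "frj_rule G (map concl (subs d)) w"
    using is_derivation_rule assms(1) d(1,2) by blast
  then have atomic: "Lhs w \<subseteq> Vars \<union> Imps"
    by (auto simp: frj_rule_def is_sequent_def GammaBar_def GammaAt_def GammaImp_def)
  from d(3) show ?case
  proof
    assume "axiom_shape G w"
    then show ?thesis
      using reg by (auto elim!: axiom_shape.cases simp: GammaAt_def VarsBot_def Vars_def)
  next
    assume "join_shape G (map concl (subs d)) w"
    moreover have "\<forall>p \<in> set (map concl (subs d)). is_sequent G p"
      using rule unfolding frj_rule_def by blast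
    ultimately obtain \<Gamma> C where w: "w = Reg \<Gamma> C"
      and prems: "\<forall>p \<in> set (map concl (subs d)).
        \<exists>\<Sigma> \<Theta> Y. p = Irr \<Sigma> \<Theta> Y \<and> \<Sigma> \<subseteq> \<Gamma> \<and> \<Gamma> \<subseteq> \<Sigma> \<union> \<Theta>"
      and imps: "\<forall>Y Z. Imp Y Z \<in> \<Gamma> \<longrightarrow> Y \<in> Rhs ` set (map concl (subs d))"
      and C: "C \<in> VarsBot \<and> C \<notin> \<Gamma> \<or>
        (\<exists>C1 C2. C = Or C1 C2 \<and> {C1, C2} \<subseteq> Rhs ` set (map concl (subs d)))"
      by (elim join_shapeE)
    \<comment> \<open>If the antecedent of an implication fails at \<open>w\<close>, only strictly
      higher worlds matter. There the implication lies in the closure of the left-hand side, which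
      is forced by \<open>above\<close>.\<close>
    have member: "forces (Mod G D) w H"
      if H: "H \<in> \<Gamma>" "\<And>Y Z. H = Imp Y Z \<Longrightarrow> \<not> forces (Mod G D) w Y" for H
    proof (cases "H \<in> Vars")
      case True
      then show ?thesis
        using H(1) w by (auto simp: Vars_def)
    next
      case False
      then obtain Y Z where YZ: "H = Imp Y Z"
        using atomic H(1) w by (auto simp: Imps_def)
      have "forces (Mod G D) v Z"
        if v: "v \<in> p_sequents G D" "(mapsto0 G)\<^sup>*\<^sup>* v w" "forces (Mod G D) v Y" for v
      proof -
        have "v \<noteq> w"
          using H(2) YZ v(3) by blast
        then have v_Lhs: "\<forall>H \<in> Lhs v. forces (Mod G D) v H"
          using above v by blast
        have "Imp Y Z \<in> Cl (Lhs v)"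
          using mapsto_Cl_Lhs[OF v(2)] H(1) YZ w by (auto intro: Cl_base)
        then have "forces (Mod G D) v (Imp Y Z)"
          using forces_Cl[OF K, of v] v(1) v_Lhs by (metis Mod_simps(1))
        then show ?thesis
          using v by auto
      qed
      then show ?thesis
        using YZ by simp
    qed
    \<comment> \<open>Refuting \<open>Y\<close> needs only the members of \<open>\<Gamma>\<close>
      smaller than \<open>Y\<close>. The antecedent of such an implication is again a right formula
      of some premise and smaller still, so the induction hypothesis refutes it and
      \<open>member\<close> applies.\<close>
    have refuted: "\<not> forces (Mod G D) w Y" if "Y \<in> Rhs ` set (map concl (subs d))" for Y
      using that
    proof (induction Y rule: measure_induct_rule[of size])
      case (less Y)
      obtain e where e: "e \<in> set (subs d)" "Rhs (concl e) = Y"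
        using less.prems by auto
      then obtain \<Sigma> \<Theta> where \<Sigma>: "concl e = Irr \<Sigma> \<Theta> Y" "\<Sigma> \<subseteq> \<Gamma>" "\<Gamma> \<subseteq> \<Sigma> \<union> \<Theta>"
        using prems by fastforce
      show ?case
      proof (rule irregular_refuted[OF assms \<open>w \<in> p_sequents G D\<close> above _ \<Sigma>(1)])
        show "e \<in> nodes D"
          using e(1) d(1) subs_subset_nodes nodes_trans by blast
        show "(mapsto0 G)\<^sup>*\<^sup>* (concl e) w"
          using subs_mapsto0[OF \<open>is_derivation G d\<close> e(1)] d(2) by auto
        show "forces (Mod G D) w H" if H: "H \<in> Lhs w" "size H < size Y" for H
        proof (rule member)
          show "\<not> forces (Mod G D) w Y'" if "H = Imp Y' Z" for Y' Z
            using less.IH[of Y'] imps H w that by auto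
        qed (use H w in simp)
      qed (use \<Sigma> w in simp_all)
    qed
    have "\<forall>H \<in> \<Gamma>. forces (Mod G D) w H"
      using member refuted imps by blast
    moreover have "\<not> forces (Mod G D) w C"
      using C refuted w by (auto simp: VarsBot_def Vars_def)
    ultimately show ?thesis
      using w by simp
  qed
qed

theorem theorem3p10:
  fixes G :: fm and D :: deriv
  assumes "derivation_of_goal G D"
  shows "countermodel (Mod G D) G"
proof -
  obtain \<Gamma> where D: "is_derivation G D" "concl D = Reg \<Gamma> G"
    using assms by (auto simp: derivation_of_goal_def)
  obtain C where C: "Reg \<Gamma> C \<in> p_sequents G D"
    "\<forall>s \<in> p_sequents G D. (mapsto0 G)\<^sup>*\<^sup>* s (Reg \<Gamma> C)"
    "\<forall>K (w :: seqt). kripke_model K \<longrightarrow> w \<in> worlds K \<longrightarrow> (\<forall>H \<in> \<Gamma>. forces K w H) \<longrightarrow>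
      \<not> forces K w C \<longrightarrow> \<not> forces K w G"
    by (rule regular_top[OF D])
  have K: "kripke_model (Mod G D)"
    using C(1,2) by (rule kripke_model_Mod)
  \<comment> \<open>The root shares the left-hand side \<open>\<Gamma>\<close> of the final sequent:
    it forces \<open>\<Gamma>\<close> and refutes \<open>C\<close>, and refutation carries over from
    \<open>C\<close> to \<open>G\<close>.\<close>
  have "\<not> forces (Mod G D) (Reg \<Gamma> C) G"
    using world_realizes[OF D(1) K C(1)] C(1,3) K by simp
  then show ?thesis
    unfolding countermodel_def using K root_Mod[OF C(1,2)] by simp
qed

end
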